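(* Let $M=\mathbb H^3/\Gamma$ be a finite volume hyperbolic 3-manifold, let $x\in\mathbb H^3$, and let $D_x(\Gamma)$ be the Dirichlet domain of $\Gamma$ centered at $x$. Let $g,g'$ be elements of $\Gamma$ (given, for instance, as words in generators of $\Gamma$ and their inverses). If the real parts of the traces of $g$ and $g'$ are the same and the distance $d(g(x),g'(x))$ is less than twice the injectivity radius of $D_x(\Gamma)$, then $g$ and $g'$ represent the same element of $\Gamma$.
   Context: A hyperbolic 3-manifold is a quotient $M=\mathbb H^3/\Gamma$ with $\Gamma\subset PSL(2,\mathbb C)$ a subgroup acting freely and properly discontinuously on $\mathbb H^3$; $d$ is the hyperbolic distance. Traces of elements of $PSL(2,\mathbb C)$ are traces of representing matrices in $SL(2,\mathbb C)$, defined up to sign, and equality of real parts is understood up to sign. The Dirichlet domain of $\Gamma$ centered at $x$ is $D_x(\Gamma)=\{y\in\mathbb H^3: d(x,y)\le d(g(x),y)\ \text{for all } g\in\Gamma\setminus\{1\}\}$; since $M$ has finite volume, it is a finite sided convex polyhedron. Its injectivity radius is the minimal distance from the basepoint $x$ to a face of $D_x(\Gamma)$, i.e. the radius of the largest ball centered at $x$ inscribed in $D_x(\Gamma)$. *)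

theory Defs
  imports "HOL-Analysis.Analysis" "HOL-Algebra.Coset"
begin

definition SL2C :: "(complex^2^2) monoid" where
  "SL2C = \<lparr>carrier = {A. det A = 1}, mult = (**), one = mat 1\<rparr>"

text \<open>Elements of \<open>PSL2C\<close> are cosets, i.e. two-element sets \<open>{A, - A}\<close> of matrices in \<open>SL2C\<close>.\<close>

definition PSL2C :: "(complex^2^2) set monoid" where
  "PSL2C = SL2C Mod {mat 1, - mat 1}"

text \<open>Hyperbolic 3-space is the upper half-space model; its topology and its Borel sets are
  those induced from \<^typ>\<open>complex \<times> real\<close>.\<close>

definition H3 :: "(complex \<times> real) set" where
  "H3 = {p. 0 < snd p}"

definition hdist :: "complex \<times> real \<Rightarrow> complex \<times> real \<Rightarrow> real" where
  "hdist p q = arcosh (1 + (dist p q)\<^sup>2 / (2 * snd p * snd q))"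

definition hvol :: "(complex \<times> real) set \<Rightarrow> ennreal" where
  "hvol S = (\<integral>\<^sup>+p\<in>S. ennreal (1 / snd p ^ 3) \<partial>lborel)"

text \<open>Poincare extension of the Moebius transformation of \<open>A\<close>: with \<open>p = z + t j\<close> a
  quaternion this is \<open>(a p + b) (c p + d)\<^sup>-\<^sup>1\<close>, where \<open>det A = 1\<close>.\<close>

definition sl_act :: "complex^2^2 \<Rightarrow> complex \<times> real \<Rightarrow> complex \<times> real" where
  "sl_act A p =
    (let a = A$1$1; b = A$1$2; c = A$2$1; d = A$2$2; z = fst p; t = snd p;
         n = (cmod (c * z + d))\<^sup>2 + (cmod c)\<^sup>2 * t\<^sup>2
     in (((a * z + b) * cnj (c * z + d) + a * cnj c * of_real (t\<^sup>2)) / of_real n, t / n))"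

text \<open>Both matrices in the class \<open>g\<close> act in the same way; see \<open>psl_act_eq\<close> below.\<close>

definition psl_act :: "(complex^2^2) set \<Rightarrow> complex \<times> real \<Rightarrow> complex \<times> real" where
  "psl_act g p = the_elem ((\<lambda>A. sl_act A p) ` g)"

text \<open>Traces are defined up to sign, so real parts agree up to sign iff they agree for
  some choice of representatives.\<close>

definition same_Re_trace :: "(complex^2^2) set \<Rightarrow> (complex^2^2) set \<Rightarrow> bool" where
  "same_Re_trace g g' \<longleftrightarrow> (\<exists>A\<in>g. \<exists>B\<in>g'. Re (trace A) = Re (trace B))"

definition acts_freely :: "(complex^2^2) set set \<Rightarrow> bool" where
  "acts_freely \<Gamma> \<longleftrightarrow> (\<forall>g\<in>\<Gamma>. \<forall>p\<in>H3. psl_act g p = p \<longrightarrow> g = \<one>\<^bsub>PSL2C\<^esub>)"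

definition acts_properly_discontinuously :: "(complex^2^2) set set \<Rightarrow> bool" where
  "acts_properly_discontinuously \<Gamma> \<longleftrightarrow>
    (\<forall>K. compact K \<and> K \<subseteq> H3 \<longrightarrow> finite {g\<in>\<Gamma>. psl_act g ` K \<inter> K \<noteq> {}})"

definition hyperbolic_3_manifold_group :: "(complex^2^2) set set \<Rightarrow> bool" where
  "hyperbolic_3_manifold_group \<Gamma> \<longleftrightarrow>
    subgroup \<Gamma> PSL2C \<and> acts_freely \<Gamma> \<and> acts_properly_discontinuously \<Gamma>"

text \<open>The projection of \<open>H3\<close> onto the quotient by \<open>\<Gamma>\<close> is locally volume preserving, so
  it restricts to a volume preserving bijection from any Borel set of orbit representatives
  onto the quotient. The volume of the quotient is the volume of any such set.\<close>

definition finite_volume_quotient :: "(complex^2^2) set set \<Rightarrow> bool" where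
  "finite_volume_quotient \<Gamma> \<longleftrightarrow>
    (\<exists>F\<in>sets borel. F \<subseteq> H3 \<and> (\<forall>p\<in>H3. \<exists>!q. q \<in> F \<and> (\<exists>g\<in>\<Gamma>. q = psl_act g p)) \<and> hvol F < \<infinity>)"

definition dirichlet_domain ::
  "(complex^2^2) set set \<Rightarrow> complex \<times> real \<Rightarrow> (complex \<times> real) set" where
  "dirichlet_domain \<Gamma> x =
    {y\<in>H3. \<forall>g\<in>\<Gamma> - {\<one>\<^bsub>PSL2C\<^esub>}. hdist x y \<le> hdist (psl_act g x) y}"

definition bisector :: "complex \<times> real \<Rightarrow> complex \<times> real \<Rightarrow> (complex \<times> real) set" where
  "bisector p q = {y\<in>H3. hdist p y = hdist q y}"

text \<open>Faces are the two-dimensional ones: the intersections of the domain with a bounding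
  bisector that have nonempty interior in that bisector.\<close>

definition dirichlet_faces ::
  "(complex^2^2) set set \<Rightarrow> complex \<times> real \<Rightarrow> (complex \<times> real) set set" where
  "dirichlet_faces \<Gamma> x =
    {dirichlet_domain \<Gamma> x \<inter> bisector x (psl_act g x) | g.
       g \<in> \<Gamma> - {\<one>\<^bsub>PSL2C\<^esub>} \<and>
       (top_of_set (bisector x (psl_act g x))) interior_of
         (dirichlet_domain \<Gamma> x \<inter> bisector x (psl_act g x)) \<noteq> {}}"

text \<open>The infimum is over a nonempty set when \<open>\<Gamma>\<close> is nontrivial, in particular when the
  quotient has finite volume.\<close>

definition dirichlet_inj_radius :: "(complex^2^2) set set \<Rightarrow> complex \<times> real \<Rightarrow> real" where
  "dirichlet_inj_radius \<Gamma> x = (INF F\<in>dirichlet_faces \<Gamma> x. INF y\<in>F. hdist x y)"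

lemma det_uminus_2: "det (- A) = det (A :: complex^2^2)"
  by (simp add: det_2)

lemma group_SL2C: "group SL2C"
proof (rule groupI)
  fix A assume A: "A \<in> carrier SL2C"
  then have "invertible A"
    by (simp add: SL2C_def invertible_det_nz)
  then obtain B where B: "A ** B = mat 1" "B ** A = mat 1"
    unfolding invertible_def by blast
  then have "det A * det B = 1"
    by (metis det_I det_mul)
  with A B show "\<exists>B\<in>carrier SL2C. B \<otimes>\<^bsub>SL2C\<^esub> A = \<one>\<^bsub>SL2C\<^esub>"
    by (auto simp: SL2C_def)
qed (auto simp: SL2C_def det_mul matrix_mul_assoc)

lemma uminus_one_mult: "(- mat 1) ** A = - (A :: complex^2^2)" "A ** (- mat 1) = - A"
  by (simp_all add: matrix_matrix_mult_def mat_def vec_eq_iff forall_2 sum_2)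

lemma normal_center_SL2C: "{mat 1, - mat 1} \<lhd> SL2C"
proof -
  interpret group SL2C by (rule group_SL2C)
  have inv: "inv\<^bsub>SL2C\<^esub> (- mat 1) = - mat 1"
    by (rule inv_equality) (auto simp: SL2C_def det_uminus_2 uminus_one_mult)
  have "subgroup {mat 1, - mat 1} SL2C"
  proof (rule subgroupI)
    fix A assume "A \<in> {mat 1, - mat 1 :: complex^2^2}"
    then show "inv\<^bsub>SL2C\<^esub> A \<in> {mat 1, - mat 1}"
      using inv inv_one by (auto simp: SL2C_def)
  qed (auto simp: SL2C_def det_uminus_2 uminus_one_mult)
  then show ?thesis
    by (rule normalI) (auto simp: SL2C_def r_coset_def l_coset_def uminus_one_mult)
qed

lemma group_PSL2C: "group PSL2C"
  unfolding PSL2C_def by (rule normal.factorgroup_is_group[OF normal_center_SL2C])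

lemma carrier_PSL2C: "carrier PSL2C = {{A, - A} | A. det A = 1}"
  by (auto simp: PSL2C_def FactGroup_def RCOSETS_def r_coset_def SL2C_def uminus_one_mult)

lemma one_PSL2C: "\<one>\<^bsub>PSL2C\<^esub> = {mat 1, - mat 1}"
  by (simp add: PSL2C_def FactGroup_def)

lemma sl_act_uminus: "sl_act (- A) p = sl_act A p"
proof -
  have "cmod (- (c * z) - d) = cmod (c * z + d)" for c z d :: complex
    by (metis norm_minus_cancel minus_add_distrib uminus_add_conv_diff add.commute)
  then show ?thesis
    by (simp add: sl_act_def Let_def algebra_simps)
qed

lemma psl_act_eq: "psl_act {A, - A} p = sl_act A p"
  by (simp add: psl_act_def sl_act_uminus)

end

(*
  If g and g' differ, then h = inv g * g' is a nontrivial element of the group, and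
  d(gx, g'x) = d(x, hx), so it suffices that every nontrivial h moves x by at least twice the
  injectivity radius. Let kx be nearest to x among the orbit points other than x. The midpoint m
  of x and kx is strictly closer to x than to every orbit point other than x and kx, and by local
  finiteness this persists near m. Hence the bisector of x and kx meets the Dirichlet domain in a
  face through m, and the injectivity radius is at most d(x, m) = d(x, kx) / 2.
*)

theory Submission
  imports Defs
begin

section \<open>Hyperbolic cosine of the distance\<close>

definition hcosh :: "complex \<times> real \<Rightarrow> complex \<times> real \<Rightarrow> real" where
  "hcosh p q = 1 + (dist p q)\<^sup>2 / (2 * snd p * snd q)"

lemma hdist_eq_arcosh: "hdist p q = arcosh (hcosh p q)"
  by (simp add: hdist_def hcosh_def)

lemma hcosh_commute: "hcosh p q = hcosh q p"
  by (simp add: hcosh_def dist_commute mult_ac)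

lemma hcosh_self [simp]: "hcosh p p = 1"
  by (simp add: hcosh_def)

lemma hcosh_ge_1: "p \<in> H3 \<Longrightarrow> q \<in> H3 \<Longrightarrow> 1 \<le> hcosh p q"
  by (simp add: hcosh_def H3_def)

lemma hcosh_gt_1: "p \<in> H3 \<Longrightarrow> q \<in> H3 \<Longrightarrow> p \<noteq> q \<Longrightarrow> 1 < hcosh p q"
  by (simp add: hcosh_def H3_def)

text \<open>Expanding the squared height difference absorbs the summand 1. This fraction is the form
  used in all coordinate computations.\<close>

lemma hcosh_eq:
  assumes "p \<in> H3" "q \<in> H3"
  shows "hcosh p q =
    ((cmod (fst p - fst q))\<^sup>2 + (snd p)\<^sup>2 + (snd q)\<^sup>2) / (2 * snd p * snd q)"
proof -
  have "(dist p q)\<^sup>2 = (cmod (fst p - fst q))\<^sup>2 + (snd p - snd q)\<^sup>2"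
    by (simp add: dist_prod_def dist_norm)
  then show ?thesis
    using assms by (simp add: hcosh_def H3_def power2_diff field_simps)
qed

lemma continuous_on_hcosh: "p \<in> H3 \<Longrightarrow> continuous_on H3 (hcosh p)"
  unfolding hcosh_def by (intro continuous_intros) (auto simp: H3_def)

lemma open_H3: "open H3"
  unfolding H3_def by (intro open_Collect_less continuous_intros)

text \<open>Openness of the strict sides of bisectors lets finitely many strict inequalities at a
  point persist nearby.\<close>

lemma open_hcosh_less:
  assumes "p \<in> H3" "q \<in> H3"
  shows "open {y\<in>H3. hcosh p y < hcosh q y}"
proof -
  have "open (H3 \<inter> (\<lambda>y. hcosh q y - hcosh p y) -` {0<..})"
    using assms
    by (intro continuous_open_preimage continuous_intros continuous_on_hcosh open_H3) auto
  also have "H3 \<inter> (\<lambda>y. hcosh q y - hcosh p y) -` {0<..} = {y\<in>H3. hcosh p y < hcosh q y}"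
    by auto
  finally show ?thesis .
qed

lemma cosh_hdist: "p \<in> H3 \<Longrightarrow> q \<in> H3 \<Longrightarrow> cosh (hdist p q) = hcosh p q"
  by (simp add: hdist_eq_arcosh hcosh_ge_1 cosh_arcosh_real)

lemma hdist_nonneg: "p \<in> H3 \<Longrightarrow> q \<in> H3 \<Longrightarrow> 0 \<le> hdist p q"
  by (simp add: hdist_eq_arcosh hcosh_ge_1)

text \<open>As \<open>cosh\<close> is increasing on nonnegative reals, distances can be compared
  through the algebraic expression \<open>hcosh\<close>.\<close>

lemma hdist_le_iff:
  assumes "p \<in> H3" "q \<in> H3" "p' \<in> H3" "q' \<in> H3"
  shows "hdist p q \<le> hdist p' q' \<longleftrightarrow> hcosh p q \<le> hcosh p' q'"
  using assms cosh_real_nonneg_le_iff[OF hdist_nonneg hdist_nonneg]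
  by (simp add: cosh_hdist)


subsection \<open>Action by isometries\<close>

text \<open>The positive definite Hermitian matrices of determinant 1 form the hyperboloid model; in it
  \<open>A\<close> acts by \<open>H \<mapsto> A H A\<^sup>*\<close>, and \<^const>\<open>hcosh\<close> is the polarization of the determinant.\<close>

definition hermitian :: "complex \<times> real \<Rightarrow> complex^2^2" where
  "hermitian p = (let z = fst p; t = snd p in
    vector [vector [of_real (((cmod z)\<^sup>2 + t\<^sup>2) / t), z / of_real t],
            vector [cnj z / of_real t, 1 / of_real t]])"

definition adjoint_matrix :: "complex^2^2 \<Rightarrow> complex^2^2" where
  "adjoint_matrix A = (\<chi> i j. cnj (A $ j $ i))"

lemma adjoint_matrix_mult: "adjoint_matrix (A ** B) = adjoint_matrix B ** adjoint_matrix A"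
  by (simp add: adjoint_matrix_def matrix_matrix_mult_def vec_eq_iff mult_ac)

lemma det_adjoint_matrix: "det (adjoint_matrix A) = cnj (det A)"
  by (simp add: adjoint_matrix_def det_2)

lemma matrix_2_eqI:
  fixes A B :: "'a^2^2"
  assumes "A$1$1 = B$1$1" "A$1$2 = B$1$2" "A$2$1 = B$2$1" "A$2$2 = B$2$2"
  shows "A = B"
  using assms by (simp add: vec_eq_iff forall_2)

text \<open>The lower right entry recovers the height, and then the upper right entry recovers the
  complex coordinate.\<close>

lemma hermitian_inj:
  assumes "p \<in> H3" "q \<in> H3" "hermitian p = hermitian q"
  shows "p = q"
proof -
  have "hermitian p $ 2 $ 2 = hermitian q $ 2 $ 2" "hermitian p $ 1 $ 2 = hermitian q $ 1 $ 2"
    using assms by simp_all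
  then show ?thesis
    using assms(1,2) by (auto simp: hermitian_def Let_def H3_def prod_eq_iff)
qed

text \<open>On 2 by 2 matrices \<open>det\<close> is a quadratic form: each summand contributes its
  determinant 1, and the mixed term is \<open>2 * hcosh p q\<close>.\<close>

lemma det_hermitian_add:
  assumes "p \<in> H3" "q \<in> H3"
  shows "det (hermitian p + hermitian q) = of_real (2 + 2 * hcosh p q)"
proof -
  obtain x y t u v s where pq: "p = (Complex x y, t)" "q = (Complex u v, s)"
    by (metis complex_surj surj_pair)
  have "t > 0" "s > 0"
    using assms by (auto simp: H3_def pq)
  then show ?thesis
    using assms
    by (simp add: hcosh_eq hermitian_def Let_def det_2 pq complex_eq_iff cmod_power2)
      (simp add: field_simps power2_eq_square)
qed

lemma sl_act_denom_pos:
  fixes A :: "complex^2^2"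
  assumes "det A = 1" "t > 0"
  shows "(cmod (A$2$1 * z + A$2$2))\<^sup>2 + (cmod (A$2$1))\<^sup>2 * t\<^sup>2 > 0"
proof (cases "A$2$1 = 0")
  case True
  then have "A$2$2 \<noteq> 0" using assms by (auto simp: det_2)
  then show ?thesis using True by simp
next
  case False
  then show ?thesis using assms by (intro add_nonneg_pos) auto
qed

lemma sl_act_in_H3: "det A = 1 \<Longrightarrow> p \<in> H3 \<Longrightarrow> sl_act A p \<in> H3"
  using sl_act_denom_pos[of A "snd p" "fst p"] by (simp add: sl_act_def Let_def H3_def)

text \<open>Lagrange's identity; with \<open>u = a z + b\<close> and \<open>v = c z + d\<close> the last factor on the left is
  \<open>det A\<close>.\<close>

lemma lagrange_identity_complex:
  "(cmod (u * cnj v + a * cnj c * of_real (t\<^sup>2)))\<^sup>2 + t\<^sup>2 * (cmod (a * v - c * u))\<^sup>2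
    = ((cmod v)\<^sup>2 + (cmod c)\<^sup>2 * t\<^sup>2) * ((cmod u)\<^sup>2 + (cmod a)\<^sup>2 * t\<^sup>2)"
proof -
  \<comment> \<open>Over the complex numbers each squared modulus is a product with a conjugate, so
    the claim becomes a ring identity.\<close>
  have "complex_of_real ((cmod (u * cnj v + a * cnj c * of_real (t\<^sup>2)))\<^sup>2
      + t\<^sup>2 * (cmod (a * v - c * u))\<^sup>2)
    = of_real (((cmod v)\<^sup>2 + (cmod c)\<^sup>2 * t\<^sup>2) * ((cmod u)\<^sup>2 + (cmod a)\<^sup>2 * t\<^sup>2))"
    unfolding of_real_add of_real_mult complex_norm_square by (simp add: algebra_simps power2_eq_square)
  then show ?thesis
    by (simp only: of_real_eq_iff)
qed

text \<open>This equivariance reduces the action law and the invariance of distance to matrix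
  algebra.\<close>

lemma hermitian_sl_act:
  assumes A: "det A = 1" and p: "p \<in> H3"
  shows "hermitian (sl_act A p) = A ** hermitian p ** adjoint_matrix A"
proof -
  define a b c d where abcd: "a = A$1$1" "b = A$1$2" "c = A$2$1" "d = A$2$2"
  obtain z t where zt: "p = (z, t)" by fastforce
  have t: "t > 0" using p by (simp add: H3_def zt)
  define u v where uv: "u = a * z + b" "v = c * z + d"
  define n where "n = (cmod v)\<^sup>2 + (cmod c)\<^sup>2 * t\<^sup>2"
  define w where "w = u * cnj v + a * cnj c * of_real (t\<^sup>2)"
  have n: "n > 0"
    using sl_act_denom_pos[OF A t, of z] by (simp add: n_def uv abcd)
  have act: "sl_act A p = (w / of_real n, t / n)"
    by (simp add: sl_act_def Let_def zt n_def w_def uv abcd)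
  \<comment> \<open>Lagrange's identity now exhibits the factor \<open>n\<close>, which cancels from
    the upper left entry.\<close>
  have "a * v - c * u = 1"
    using A by (simp add: uv abcd det_2 algebra_simps)
  then have lag: "(cmod w)\<^sup>2 + t\<^sup>2 = n * ((cmod u)\<^sup>2 + (cmod a)\<^sup>2 * t\<^sup>2)"
    using lagrange_identity_complex[of u v a c t] by (simp add: w_def n_def)
  have "((cmod (w / of_real n))\<^sup>2 + (t / n)\<^sup>2) / (t / n) = ((cmod w)\<^sup>2 + t\<^sup>2) / (n * t)"
    using n t by (simp add: norm_divide field_simps power2_eq_square)
  then have top: "((cmod (w / of_real n))\<^sup>2 + (t / n)\<^sup>2) / (t / n)
      = ((cmod u)\<^sup>2 + (cmod a)\<^sup>2 * t\<^sup>2) / t"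
    using n t lag by simp
  have lhs: "hermitian (sl_act A p)
    = vector [vector [of_real (((cmod u)\<^sup>2 + (cmod a)\<^sup>2 * t\<^sup>2) / t), w / of_real t],
              vector [cnj w / of_real t, of_real n / of_real t]]"
    unfolding hermitian_def act Let_def fst_conv snd_conv top
    using n t by (simp add: field_simps)
  have norm_sq: "(complex_of_real (cmod y))\<^sup>2 = y * cnj y" for y
    by (metis complex_norm_square of_real_power)
  show ?thesis
    unfolding lhs
    using t
    by (intro matrix_2_eqI; simp add: hermitian_def zt Let_def matrix_matrix_mult_def sum_2
        adjoint_matrix_def abcd[symmetric] w_def n_def uv norm_sq)
      (simp_all add: field_simps power2_eq_square)
qed

text \<open>Both sides have the same Hermitian matrix, because the adjoint reverses
  products.\<close>

lemma sl_act_mult: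
  assumes "det A = 1" "det B = 1" "p \<in> H3"
  shows "sl_act (A ** B) p = sl_act A (sl_act B p)"
  using assms
  by (intro hermitian_inj)
    (simp_all add: sl_act_in_H3 hermitian_sl_act det_mul adjoint_matrix_mult matrix_mul_assoc)

lemma matrix_add_rdistrib: "(A + B) ** C = A ** C + B ** (C :: 'a::semiring_1^'n^'m)"
  by (simp add: matrix_matrix_mult_def vec_eq_iff distrib_right sum.distrib)

text \<open>The map \<open>H\<close> to \<open>A ** H ** adjoint_matrix A\<close> is additive and
  preserves \<open>det\<close>, hence preserves the determinant of a sum of two points.\<close>

lemma hcosh_sl_act:
  assumes A: "det A = 1" and p: "p \<in> H3" and q: "q \<in> H3"
  shows "hcosh (sl_act A p) (sl_act A q) = hcosh p q"
proof -
  have "complex_of_real (2 + 2 * hcosh (sl_act A p) (sl_act A q))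
      = det (A ** (hermitian p + hermitian q) ** adjoint_matrix A)"
    using assms
    by (simp only: det_hermitian_add[symmetric] sl_act_in_H3 hermitian_sl_act
        matrix_add_ldistrib matrix_add_rdistrib)
  also have "\<dots> = of_real (2 + 2 * hcosh p q)"
    using assms by (simp only: det_mul det_adjoint_matrix det_hermitian_add) simp
  finally show ?thesis
    by (simp only: of_real_eq_iff)
qed

section \<open>Passage to PSL(2,C)\<close>

lemma PSL2C_cases:
  assumes "g \<in> carrier PSL2C"
  obtains A where "g = {A, - A}" "det A = 1"
  using assms by (auto simp: carrier_PSL2C)

lemma PSL2C_mult: "{A, - A} \<otimes>\<^bsub>PSL2C\<^esub> {B, - B} = {A ** B, - (A ** B)}"
proof -
  have "- A ** B = - (A ** B)" "A ** - B = - (A ** B)" "- A ** - B = A ** B"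
    by (simp_all add: matrix_matrix_mult_def vec_eq_iff sum_negf)
  then show ?thesis
    by (auto simp: PSL2C_def FactGroup_def set_mult_def SL2C_def)
qed

lemma psl_act_in_H3: "g \<in> carrier PSL2C \<Longrightarrow> p \<in> H3 \<Longrightarrow> psl_act g p \<in> H3"
  by (elim PSL2C_cases) (simp add: psl_act_eq sl_act_in_H3)

lemma hcosh_psl_act:
  "g \<in> carrier PSL2C \<Longrightarrow> p \<in> H3 \<Longrightarrow> q \<in> H3 \<Longrightarrow> hcosh (psl_act g p) (psl_act g q) = hcosh p q"
  by (elim PSL2C_cases) (simp add: psl_act_eq hcosh_sl_act)

lemma psl_act_mult:
  "g \<in> carrier PSL2C \<Longrightarrow> h \<in> carrier PSL2C \<Longrightarrow> p \<in> H3 \<Longrightarrow>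
    psl_act (g \<otimes>\<^bsub>PSL2C\<^esub> h) p = psl_act g (psl_act h p)"
  by (elim PSL2C_cases) (simp add: psl_act_eq PSL2C_mult sl_act_mult)

lemma psl_act_one: "psl_act \<one>\<^bsub>PSL2C\<^esub> p = p"
  by (simp add: one_PSL2C psl_act_eq sl_act_def Let_def mat_def)


subsection \<open>Midpoints\<close>

text \<open>In the hyperboloid model the midpoint is the normalized sum of the end points.\<close>

lemma hyperbolic_midpoint:
  assumes "p \<in> H3" "q \<in> H3"
  obtains m where "m \<in> H3"
    "\<And>y. y \<in> H3 \<Longrightarrow> hcosh y m = (hcosh y p + hcosh y q) / sqrt (2 + 2 * hcosh p q)"
proof -
  obtain z t w s where pq: "p = (z, t)" "q = (w, s)" by fastforce
  have ts: "t > 0" "s > 0" using assms by (auto simp: H3_def pq)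
  \<comment> \<open>In \<open>hermitian p + hermitian q\<close> the lower right entry is \<alpha>,
    the upper right one \<beta>, and the determinant \<open>K\<^sup>2\<close>. The point
    \<open>m\<close> below has this sum divided by \<open>K\<close> as its matrix.\<close>
  define K where "K = sqrt (2 + 2 * hcosh p q)"
  define \<alpha> where "\<alpha> = 1 / t + 1 / s"
  define \<beta> where "\<beta> = z / of_real t + w / of_real s"
  have \<alpha>: "\<alpha> > 0" using ts by (simp add: \<alpha>_def add_pos_pos)
  have K2: "K\<^sup>2 = 2 + 2 * hcosh p q" and K: "K > 0"
    using hcosh_ge_1[OF assms] by (simp_all add: K_def)
  define m where "m = (\<beta> / of_real \<alpha>, K / \<alpha>)"
  have m: "m \<in> H3" using K \<alpha> by (simp add: m_def H3_def)
  \<comment> \<open>The determinant of the sum, written out in its entries.\<close>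
  have norm_m: "(cmod \<beta>)\<^sup>2 + K\<^sup>2 = \<alpha> * (((cmod z)\<^sup>2 + t\<^sup>2) / t + ((cmod w)\<^sup>2 + s\<^sup>2) / s)"
    unfolding K2 hcosh_eq[OF assms] \<alpha>_def \<beta>_def cmod_power2
    using ts by (simp add: pq) (simp add: field_simps power2_eq_square)
  have dist_sq: "(cmod (v - u))\<^sup>2 = (cmod v)\<^sup>2 - 2 * (v \<bullet> u) + (cmod u)\<^sup>2" for v u
    by (simp add: power2_norm_eq_inner inner_diff inner_commute)
  have "hcosh y m = (hcosh y p + hcosh y q) / K" if y: "y \<in> H3" for y
  proof -
    obtain v r where vr: "y = (v, r)" by fastforce
    have r: "r > 0" using y by (simp add: H3_def vr)
    \<comment> \<open>\<open>N / (2 * r)\<close> is half the mixed term of \<open>det\<close> for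
      \<open>hermitian y\<close> and the sum. It is linear in the sum, so it splits into the
      contributions of \<open>p\<close> and \<open>q\<close>.\<close>
    define N where "N = \<alpha> * ((cmod v)\<^sup>2 + r\<^sup>2) - 2 * (v \<bullet> \<beta>)
      + (((cmod z)\<^sup>2 + t\<^sup>2) / t + ((cmod w)\<^sup>2 + s\<^sup>2) / s)"
    have "v \<bullet> (\<beta> / of_real \<alpha>) = (v \<bullet> \<beta>) / \<alpha>"
      using \<alpha> by (simp add: inner_complex_def field_simps)
    then have "hcosh y m = ((cmod v)\<^sup>2 - 2 * (v \<bullet> \<beta>) / \<alpha> + ((cmod \<beta>)\<^sup>2 + K\<^sup>2) / \<alpha>\<^sup>2 + r\<^sup>2)
        / (2 * r * (K / \<alpha>))"
      unfolding hcosh_eq[OF y m]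
      using \<alpha> by (simp add: vr m_def dist_sq norm_divide power_divide add_divide_distrib
          algebra_simps)
    also have "\<dots> = N / (2 * r) / K"
      unfolding norm_m N_def using \<alpha> r K by (simp add: field_simps power2_eq_square)
    also have "N / (2 * r) = hcosh y p + hcosh y q"
    proof -
      have v\<beta>: "v \<bullet> \<beta> = (v \<bullet> z) / t + (v \<bullet> w) / s"
        by (simp add: \<beta>_def inner_complex_def Re_divide_of_real Im_divide_of_real
            add_divide_distrib algebra_simps)
      have hyp: "hcosh y p = ((cmod v)\<^sup>2 - 2 * (v \<bullet> z) + (cmod z)\<^sup>2 + r\<^sup>2 + t\<^sup>2) / (2 * r * t)"
        "hcosh y q = ((cmod v)\<^sup>2 - 2 * (v \<bullet> w) + (cmod w)\<^sup>2 + r\<^sup>2 + s\<^sup>2) / (2 * r * s)"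
        unfolding hcosh_eq[OF y assms(1)] hcosh_eq[OF y assms(2)] by (simp_all add: pq vr dist_sq)
      show ?thesis
        using r ts by (simp only: N_def \<alpha>_def v\<beta> hyp) (simp add: field_simps power2_eq_square)
    qed
    finally show ?thesis .
  qed
  then show ?thesis using that m K_def by blast
qed


subsection \<open>Local finiteness and the nearest face\<close>

text \<open>Hyperbolic balls are relatively compact, uniformly for centers in a box.\<close>

lemma hcosh_bounded_in_box:
  assumes p: "p \<in> H3" and y: "y \<in> H3" and c: "hcosh p y \<le> c"
  shows "snd y / (2 * c) \<le> snd p" "snd p \<le> 2 * c * snd y" "cmod (fst p - fst y) \<le> 2 * c * snd y"
proof -
  obtain z t w s where pq: "p = (z, t)" "y = (w, s)" by fastforce
  have ts: "t > 0" "s > 0" using assms by (auto simp: H3_def pq)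
  have c1: "c \<ge> 1" using hcosh_ge_1[OF p y] c by simp
  have le: "(cmod (z - w))\<^sup>2 + t\<^sup>2 + s\<^sup>2 \<le> 2 * c * t * s"
    using c ts unfolding hcosh_eq[OF p y] by (simp add: pq field_simps)
  \<comment> \<open>Dropping squares from \<open>le\<close> bounds each height by a multiple of the
    other, and then the horizontal distance.\<close>
  have "t * t \<le> (2 * c * s) * t"
    using le zero_le_power2[of s] zero_le_power2[of "cmod (z - w)"]
    unfolding power2_eq_square by argo
  then have t_le: "t \<le> 2 * c * s" using ts by simp
  have "s * s \<le> (2 * c * t) * s"
    using le zero_le_power2[of t] zero_le_power2[of "cmod (z - w)"]
    unfolding power2_eq_square by argo
  then have s_le: "s \<le> 2 * c * t" using ts by simp
  have "2 * c * t * s \<le> 2 * c * (2 * c * s) * s"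
    using t_le ts c1 by (intro mult_mono) auto
  with le have "(cmod (z - w))\<^sup>2 \<le> (2 * c * s)\<^sup>2"
    using zero_le_power2[of t] zero_le_power2[of s] unfolding power2_eq_square by argo
  then have "cmod (z - w) \<le> 2 * c * s"
    using ts c1 by (simp add: abs_le_square_iff[symmetric])
  with t_le s_le c1 show "snd y / (2 * c) \<le> snd p" "snd p \<le> 2 * c * snd y"
    "cmod (fst p - fst y) \<le> 2 * c * snd y"
    by (auto simp: pq field_simps)
qed

lemma manifold_group_carrier: "hyperbolic_3_manifold_group \<Gamma> \<Longrightarrow> \<Gamma> \<subseteq> carrier PSL2C"
  by (auto simp: hyperbolic_3_manifold_group_def subgroup_def)

text \<open>Orbit points within bounded distance of a small box around \<open>m\<close> lie in a
  compact box, to which proper discontinuity applies.\<close>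

lemma orbit_locally_finite:
  assumes \<Gamma>: "hyperbolic_3_manifold_group \<Gamma>" and x: "x \<in> H3" and m: "m \<in> H3"
  obtains V where "open V" "m \<in> V" "V \<subseteq> H3"
    "finite {g\<in>\<Gamma>. \<exists>y\<in>V. hcosh (psl_act g x) y \<le> c}"
proof -
  define s where "s = snd m"
  have s: "s > 0" using m by (simp add: s_def H3_def)
  \<comment> \<open>The maximum keeps the lower height bound of \<open>K\<close> positive for
    arbitrary \<open>c\<close>.\<close>
  define C where "C = max c 1"
  have C: "C \<ge> 1" "c \<le> C" by (simp_all add: C_def)
  define V where "V = ball (fst m) s \<times> {s / 2<..<2 * s}"
  have V: "open V" "m \<in> V" "V \<subseteq> H3"
    using s by (auto simp: V_def open_Times H3_def s_def mem_Times_iff)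
  \<comment> \<open>The bounds come from \<open>hcosh_bounded_in_box\<close> with heights in
    \<open>V\<close> between \<open>s / 2\<close> and \<open>2 * s\<close>; the extra
    \<open>s\<close> is the radius of the ball in \<open>V\<close>.\<close>
  define K where "K = cball (fst m) (4 * C * s + s) \<times> {s / (4 * C)..4 * C * s}"
  have "s / (4 * C) > 0" using s C by simp
  \<comment> \<open>Adding \<open>x\<close> makes every \<open>g\<close> that sends \<open>x\<close>
    into \<open>K\<close> move this compact set to one meeting it.\<close>
  then have "compact (insert x K)" "insert x K \<subseteq> H3"
    using x by (auto simp: K_def H3_def intro!: compact_insert compact_Times)
  then have fin: "finite {g\<in>\<Gamma>. psl_act g ` insert x K \<inter> insert x K \<noteq> {}}"
    using \<Gamma> unfolding hyperbolic_3_manifold_group_def acts_properly_discontinuously_def by blast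
  have "p \<in> K" if p: "p \<in> H3" and y: "y \<in> V" and "hcosh p y \<le> c" for p y
  proof -
    have yH: "y \<in> H3" and "hcosh p y \<le> C" using V(3) that C by auto
    note box = hcosh_bounded_in_box[OF p this]
    have ys: "snd y > s / 2" "snd y < 2 * s" "dist (fst m) (fst y) < s"
      using y by (auto simp: V_def mem_Times_iff)
    have *: "2 * C * snd y \<le> 4 * C * s" using ys C s by simp
    have "s / (4 * C) \<le> snd y / (2 * C)" using ys C by (simp add: field_simps)
    moreover have "dist (fst m) (fst p) \<le> 4 * C * s + s"
      using dist_triangle[of "fst m" "fst p" "fst y"] ys box(3) *
      by (simp add: dist_norm norm_minus_commute)
    ultimately show ?thesis
      using box * by (auto simp: K_def mem_Times_iff)
  qed
  then have "{g\<in>\<Gamma>. \<exists>y\<in>V. hcosh (psl_act g x) y \<le> c}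
      \<subseteq> {g\<in>\<Gamma>. psl_act g ` insert x K \<inter> insert x K \<noteq> {}}"
    using manifold_group_carrier[OF \<Gamma>] psl_act_in_H3[OF _ x] by blast
  then have "finite {g\<in>\<Gamma>. \<exists>y\<in>V. hcosh (psl_act g x) y \<le> c}"
    using fin finite_subset by blast
  with V that show ?thesis by blast
qed

text \<open>The quotient of two elements agreeing at \<open>x\<close> fixes \<open>x\<close>, so
  freeness makes it trivial.\<close>

lemma manifold_group_orbit_inj:
  assumes \<Gamma>: "hyperbolic_3_manifold_group \<Gamma>" and x: "x \<in> H3"
    and g: "g \<in> \<Gamma>" and h: "h \<in> \<Gamma>" and eq: "psl_act g x = psl_act h x"
  shows "g = h"
proof -
  interpret group PSL2C by (rule group_PSL2C)
  have sub: "subgroup \<Gamma> PSL2C" and free: "acts_freely \<Gamma>"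
    using \<Gamma> by (auto simp: hyperbolic_3_manifold_group_def)
  have gc: "g \<in> carrier PSL2C" and hc: "h \<in> carrier PSL2C"
    using manifold_group_carrier[OF \<Gamma>] g h by auto
  have "psl_act (inv\<^bsub>PSL2C\<^esub> h \<otimes>\<^bsub>PSL2C\<^esub> g) x = psl_act (inv\<^bsub>PSL2C\<^esub> h \<otimes>\<^bsub>PSL2C\<^esub> h) x"
    using gc hc x by (simp only: psl_act_mult eq inv_closed)
  then have "psl_act (inv\<^bsub>PSL2C\<^esub> h \<otimes>\<^bsub>PSL2C\<^esub> g) x = x"
    using hc by (simp add: psl_act_one)
  moreover have "inv\<^bsub>PSL2C\<^esub> h \<otimes>\<^bsub>PSL2C\<^esub> g \<in> \<Gamma>"
    using sub g h by (simp add: subgroup.m_closed subgroup.m_inv_closed)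
  ultimately have "inv\<^bsub>PSL2C\<^esub> h \<otimes>\<^bsub>PSL2C\<^esub> g = \<one>\<^bsub>PSL2C\<^esub>"
    using free x by (auto simp: acts_freely_def)
  then show ?thesis
    using gc hc by (metis inv_closed inv_equality inv_inv)
qed

text \<open>Only finitely many orbit points are at most as far from \<open>x\<close> as that of
  \<open>h\<close>; a minimum among them is global.\<close>

lemma nearest_orbit_point:
  assumes \<Gamma>: "hyperbolic_3_manifold_group \<Gamma>" and x: "x \<in> H3"
    and h: "h \<in> \<Gamma> - {\<one>\<^bsub>PSL2C\<^esub>}"
  obtains k where "k \<in> \<Gamma> - {\<one>\<^bsub>PSL2C\<^esub>}"
    "\<And>g. g \<in> \<Gamma> - {\<one>\<^bsub>PSL2C\<^esub>} \<Longrightarrow> hcosh (psl_act k x) x \<le> hcosh (psl_act g x) x"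
proof -
  let ?f = "\<lambda>g. hcosh (psl_act g x) x"
  obtain V where V: "open V" "x \<in> V" "V \<subseteq> H3"
    "finite {g\<in>\<Gamma>. \<exists>y\<in>V. hcosh (psl_act g x) y \<le> ?f h}"
    by (rule orbit_locally_finite[OF \<Gamma> x x])
  have "finite {g\<in>\<Gamma> - {\<one>\<^bsub>PSL2C\<^esub>}. ?f g \<le> ?f h}" (is "finite ?G")
    by (rule finite_subset[OF _ V(4)]) (use V(2) in auto)
  moreover have hG: "h \<in> ?G" using h by simp
  ultimately have "\<exists>k. is_arg_min ?f (\<lambda>g. g \<in> ?G) k"
    by (intro ex_is_arg_min_if_finite) auto
  then obtain k where k: "k \<in> ?G" "\<And>g. g \<in> ?G \<Longrightarrow> ?f k \<le> ?f g"
    unfolding is_arg_min_linorder by blast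
  show ?thesis
  proof (rule that)
    show "k \<in> \<Gamma> - {\<one>\<^bsub>PSL2C\<^esub>}" using k by simp
    show "?f k \<le> ?f g" if "g \<in> \<Gamma> - {\<one>\<^bsub>PSL2C\<^esub>}" for g
      using k(2)[of g] k(2)[OF hG] that by (cases "?f g \<le> ?f h") auto
  qed
qed

lemma hdist_orbit_ge_inj_radius:
  assumes \<Gamma>: "hyperbolic_3_manifold_group \<Gamma>" and x: "x \<in> H3"
    and h: "h \<in> \<Gamma> - {\<one>\<^bsub>PSL2C\<^esub>}"
  shows "2 * dirichlet_inj_radius \<Gamma> x \<le> hdist x (psl_act h x)"
proof -
  obtain k where k: "k \<in> \<Gamma> - {\<one>\<^bsub>PSL2C\<^esub>}"
    and k_min: "\<And>g. g \<in> \<Gamma> - {\<one>\<^bsub>PSL2C\<^esub>} \<Longrightarrow> hcosh (psl_act k x) x \<le> hcosh (psl_act g x) x"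
    by (rule nearest_orbit_point[OF \<Gamma> x h]) blast
  have orb: "psl_act g x \<in> H3" if "g \<in> \<Gamma>" for g
    using manifold_group_carrier[OF \<Gamma>] that psl_act_in_H3 x by blast
  let ?q = "psl_act k x"
  have q: "?q \<in> H3" using k orb by simp
  define K where "K = sqrt (2 + 2 * hcosh x ?q)"
  obtain m where m: "m \<in> H3"
    and hm: "\<And>y. y \<in> H3 \<Longrightarrow> hcosh y m = (hcosh y x + hcosh y ?q) / K"
    unfolding K_def by (rule hyperbolic_midpoint[OF x q]) blast
  have K2: "K\<^sup>2 = 2 + 2 * hcosh x ?q" and K: "K > 0"
    using hcosh_ge_1[OF x q] by (simp_all add: K_def)
  \<comment> \<open>Half-angle formula: \<open>K / 2\<close> is the \<open>cosh\<close> of half the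
    distance from \<open>x\<close> to \<open>?q\<close>.\<close>
  have "(1 + hcosh x ?q) / K = K / 2"
    using K K2 by (simp add: divide_eq_eq eq_divide_eq power2_eq_square)
  then have xm: "hcosh x m = K / 2" and qm: "hcosh ?q m = K / 2"
    using hm[OF x] hm[OF q] by (simp_all add: hcosh_commute[of ?q x] add.commute)
  have m_inside: "hcosh x m < hcosh (psl_act g x) m" if g: "g \<in> \<Gamma> - {\<one>\<^bsub>PSL2C\<^esub>, k}" for g
  proof -
    \<comment> \<open>By the midpoint formula it suffices to compare sums of \<open>hcosh\<close> to
      the two end points. Minimality of \<open>k\<close> gives one weak inequality, and distinctness
      from \<open>?q\<close> makes the other strict.\<close>
    have "psl_act g x \<noteq> ?q"
      using manifold_group_orbit_inj[OF \<Gamma> x] g k by blast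
    then have "1 < hcosh (psl_act g x) ?q"
      using hcosh_gt_1 orb g q by simp
    moreover have "hcosh ?q x \<le> hcosh (psl_act g x) x" using k_min g by simp
    ultimately have "hcosh x x + hcosh x ?q < hcosh (psl_act g x) x + hcosh (psl_act g x) ?q"
      by (simp add: hcosh_commute)
    then show ?thesis
      using hm[OF x] hm[OF orb, of g] g K by (simp add: divide_strict_right_mono)
  qed
  \<comment> \<open>On \<open>U\<close> below, \<open>hcosh x\<close> stays under \<open>c\<close>,
    so elements whose orbit point exceeds \<open>c\<close> throughout \<open>V\<close> satisfy the
    domain inequality automatically. Only the finite set \<open>G\<close> needs explicit
    constraints.\<close>
  define c where "c = hcosh x m + 1"
  obtain V where V: "open V" "m \<in> V" "V \<subseteq> H3"
    and fin: "finite {g\<in>\<Gamma>. \<exists>y\<in>V. hcosh (psl_act g x) y \<le> c}"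
    by (rule orbit_locally_finite[OF \<Gamma> x m])
  define G where "G = {g\<in>\<Gamma>. \<exists>y\<in>V. hcosh (psl_act g x) y \<le> c} - {\<one>\<^bsub>PSL2C\<^esub>, k}"
  define U where "U = V \<inter> (H3 \<inter> hcosh x -` {..<c})
    \<inter> (\<Inter>g\<in>G. {y\<in>H3. hcosh x y < hcosh (psl_act g x) y})"
  have "open U"
    unfolding U_def using V fin x orb
    by (intro open_Int open_INT continuous_open_preimage continuous_on_hcosh open_hcosh_less open_H3 ballI)
      (auto simp: G_def)
  have "m \<in> U"
    using V m m_inside by (auto simp: U_def G_def c_def)
  let ?B = "bisector x ?q" and ?D = "dirichlet_domain \<Gamma> x"
  have U_sub: "y \<in> ?D" if y: "y \<in> U" "y \<in> ?B" for y
  proof -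
    have yH: "y \<in> H3" using y by (simp add: bisector_def)
    have "hdist x y \<le> hdist (psl_act g x) y" if g: "g \<in> \<Gamma> - {\<one>\<^bsub>PSL2C\<^esub>}" for g
    proof (cases "g = k")
      case True
      then show ?thesis using y by (simp add: bisector_def)
    next
      case False
      have "hcosh x y \<le> hcosh (psl_act g x) y"
      proof (cases "g \<in> G")
        case True
        then show ?thesis using y by (auto simp: U_def)
      next
        case notG: False
        then have "hcosh (psl_act g x) y > c"
          using y g False by (auto simp: G_def U_def not_le)
        moreover have "hcosh x y < c" using y by (simp add: U_def)
        ultimately show ?thesis by simp
      qed
      then show ?thesis using hdist_le_iff x yH orb g by simp
    qed
    then show ?thesis using yH by (simp add: dirichlet_domain_def)
  qed
  have mB: "m \<in> ?B"
    using m by (simp add: bisector_def hdist_eq_arcosh xm qm)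
  have "openin (top_of_set ?B) (?B \<inter> U)"
    using \<open>open U\<close> by (auto simp: openin_open)
  then have "m \<in> top_of_set ?B interior_of (?D \<inter> ?B)"
    unfolding interior_of_def using U_sub \<open>m \<in> U\<close> mB by blast
  then have face: "?D \<inter> ?B \<in> dirichlet_faces \<Gamma> x"
    unfolding dirichlet_faces_def using k by blast
  have nonneg: "0 \<le> hdist x y" if "y \<in> ?D" for y
    using that x hdist_nonneg by (simp add: dirichlet_domain_def)
  \<comment> \<open>A real infimum is a lower bound only for a set bounded below; this supplies that
    bound for the outer infimum.\<close>
  have "0 \<le> (INF y\<in>F. hdist x y)" if F: "F \<in> dirichlet_faces \<Gamma> x" for F
  proof (rule cINF_greatest)
    show "F \<noteq> {}"
      using F interior_of_subset unfolding dirichlet_faces_def by fastforce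
  qed (use F nonneg in \<open>auto simp: dirichlet_faces_def\<close>)
  then have "dirichlet_inj_radius \<Gamma> x \<le> (INF y\<in>?D \<inter> ?B. hdist x y)"
    unfolding dirichlet_inj_radius_def by (intro cINF_lower face bdd_belowI2)
  also have "\<dots> \<le> hdist x m"
    using U_sub[OF \<open>m \<in> U\<close> mB] mB nonneg by (intro cINF_lower bdd_belowI2[of _ 0]) auto
  finally have r: "dirichlet_inj_radius \<Gamma> x \<le> hdist x m" .
  \<comment> \<open>Double-angle formula, undoing the square root in \<open>K\<close>; nonnegativity
    then allows \<open>cosh\<close> to be cancelled.\<close>
  have "cosh (2 * hdist x m) = cosh (hdist x ?q)"
    using x m q K2 by (simp add: cosh_double_cosh cosh_hdist xm power_divide add_divide_distrib)
  then have "2 * hdist x m = hdist x ?q"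
    using cosh_real_nonneg_le_iff[of "2 * hdist x m" "hdist x ?q"]
      cosh_real_nonneg_le_iff[of "hdist x ?q" "2 * hdist x m"] hdist_nonneg x m q by simp
  also have "\<dots> \<le> hdist x (psl_act h x)"
    using k_min[OF h] hdist_le_iff x q orb h by (simp add: hcosh_commute)
  finally show ?thesis using r by simp
qed

theorem lemma3:
  fixes \<Gamma> :: "(complex^2^2) set set" and x :: "complex \<times> real" and g g' :: "(complex^2^2) set"
  assumes "hyperbolic_3_manifold_group \<Gamma>"
    and "finite_volume_quotient \<Gamma>"
    and "x \<in> H3"
    and "g \<in> \<Gamma>" and "g' \<in> \<Gamma>"
    and "same_Re_trace g g'"
    and "hdist (psl_act g x) (psl_act g' x) < 2 * dirichlet_inj_radius \<Gamma> x"
  shows "g = g'"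
proof (rule ccontr)
  interpret group PSL2C by (rule group_PSL2C)
  assume "g \<noteq> g'"
  have gc: "g \<in> carrier PSL2C" and gc': "g' \<in> carrier PSL2C"
    using manifold_group_carrier assms by auto
  define h where "h = inv\<^bsub>PSL2C\<^esub> g \<otimes>\<^bsub>PSL2C\<^esub> g'"
  have hc: "h \<in> carrier PSL2C" using gc gc' by (simp add: h_def)
  have g': "g' = g \<otimes>\<^bsub>PSL2C\<^esub> h"
    using gc gc' by (simp add: h_def m_assoc[symmetric])
  have "h \<in> \<Gamma>"
    using assms unfolding h_def hyperbolic_3_manifold_group_def
    by (simp add: subgroup.m_closed subgroup.m_inv_closed)
  moreover have "h \<noteq> \<one>\<^bsub>PSL2C\<^esub>" using g' \<open>g \<noteq> g'\<close> gc by auto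
  ultimately have "2 * dirichlet_inj_radius \<Gamma> x \<le> hdist x (psl_act h x)"
    using hdist_orbit_ge_inj_radius assms by simp
  \<comment> \<open>The isometry \<open>g\<close> carries \<open>x\<close> and
    \<open>psl_act h x\<close> to the two given points.\<close>
  also have "\<dots> = hdist (psl_act g x) (psl_act g' x)"
    using gc hc assms(3) by (simp add: g' hdist_eq_arcosh psl_act_mult hcosh_psl_act psl_act_in_H3)
  finally show False using assms(7) by simp
qed

end
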